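(* Let $\mathcal{H}$ be the genus-one curve over $\mathbb{Q}$ given by \[ \mathcal{H}:\quad V^2=9-21\lambda^2-18\lambda^3-2\lambda^4, \] and put \[ X(\lambda)=\frac{4\lambda(\lambda+1)(\lambda+3)}{(3-\lambda)(\lambda^2+3)},\qquad \rho_{\mathrm{ell}}(\lambda)=\frac{4-X(\lambda)^2}{4+X(\lambda)^2}. \] There are infinitely many distinct rational values $\rho=\rho_{\mathrm{ell}}(\lambda)$, with $(\lambda,V)\in\mathcal{H}(\mathbb{Q})$, for which at least four distinct genuine pairs exist.
   Context: A rational triangle is a triangle with rational side lengths (its area need not be rational). For $\rho\in\mathbb{Q}\cap(-1,1)$ let $\theta\in(0,\pi)$ be the angle with $\cos\theta=\rho$. A genuine pair for $\rho$ is a pair $(T,I)$ of non-degenerate rational triangles such that $T$ has an angle equal to $\theta$, $I$ is isosceles, $T$ and $I$ have the same perimeter and the same area, and $T$ and $I$ are not congruent. Genuine pairs are counted up to homothety: $(T,I)$ and $(T',I')$ are regarded as the same pair if there is a common scaling factor $\mu>0$ such that $T'$ is congruent to $\mu T$ and $I'$ is congruent to $\mu I$; otherwise they are distinct. *)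

theory Defs
  imports "HOL-Analysis.Analysis"
begin

type_synonym point = "real ^ 2"

text \<open>A triangle is given by its three vertices; the order of the vertices is irrelevant for
  everything below.\<close>

type_synonym triangle = "point \<times> point \<times> point"

fun vertices :: "triangle \<Rightarrow> point set" where
  "vertices (A, B, C) = {A, B, C}"

definition nondegenerate :: "triangle \<Rightarrow> bool" where
  "nondegenerate T \<longleftrightarrow> \<not> collinear (vertices T)"

fun rational_sides :: "triangle \<Rightarrow> bool" where
  "rational_sides (A, B, C) \<longleftrightarrow> dist A B \<in> \<rat> \<and> dist B C \<in> \<rat> \<and> dist C A \<in> \<rat>"

definition rational_triangle :: "triangle \<Rightarrow> bool" where
  "rational_triangle T \<longleftrightarrow> nondegenerate T \<and> rational_sides T"

fun perimeter :: "triangle \<Rightarrow> real" where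
  "perimeter (A, B, C) = dist A B + dist B C + dist C A"

definition area :: "triangle \<Rightarrow> real" where
  "area T = measure lborel (convex hull (vertices T))"

fun isosceles :: "triangle \<Rightarrow> bool" where
  "isosceles (A, B, C) \<longleftrightarrow> dist A B = dist B C \<or> dist B C = dist C A \<or> dist C A = dist A B"

definition angle :: "point \<Rightarrow> point \<Rightarrow> point \<Rightarrow> real" where
  "angle P Q R = arccos (((P - Q) \<bullet> (R - Q)) / (norm (P - Q) * norm (R - Q)))"

fun has_angle :: "triangle \<Rightarrow> real \<Rightarrow> bool" where
  "has_angle (A, B, C) \<theta> \<longleftrightarrow> angle C A B = \<theta> \<or> angle A B C = \<theta> \<or> angle B C A = \<theta>"

text \<open>Congruence allows orientation-reversing isometries and any matching of the vertices.\<close>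

definition congruent_triangles :: "triangle \<Rightarrow> triangle \<Rightarrow> bool" where
  "congruent_triangles T T' \<longleftrightarrow>
     (\<exists>f :: point \<Rightarrow> point. (\<forall>x y. dist (f x) (f y) = dist x y) \<and> f ` vertices T = vertices T')"

fun scale :: "real \<Rightarrow> triangle \<Rightarrow> triangle" where
  "scale \<mu> (A, B, C) = (\<mu> *\<^sub>R A, \<mu> *\<^sub>R B, \<mu> *\<^sub>R C)"

definition genuine_pair :: "rat \<Rightarrow> triangle \<times> triangle \<Rightarrow> bool" where
  "genuine_pair \<rho> = (\<lambda>(T, I).
     rational_triangle T \<and> rational_triangle I \<and>
     (\<exists>\<theta>. 0 < \<theta> \<and> \<theta> < pi \<and> cos \<theta> = of_rat \<rho> \<and> has_angle T \<theta>) \<and>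
     isosceles I \<and>
     perimeter T = perimeter I \<and> area T = area I \<and>
     \<not> congruent_triangles T I)"

definition same_pair :: "triangle \<times> triangle \<Rightarrow> triangle \<times> triangle \<Rightarrow> bool" where
  "same_pair = (\<lambda>(T, I) (T', I').
     \<exists>\<mu>>0. congruent_triangles T' (scale \<mu> T) \<and> congruent_triangles I' (scale \<mu> I))"

definition at_least_distinct_genuine_pairs :: "nat \<Rightarrow> rat \<Rightarrow> bool" where
  "at_least_distinct_genuine_pairs n \<rho> \<longleftrightarrow>
     (\<exists>P. finite P \<and> card P = n \<and> (\<forall>p\<in>P. genuine_pair \<rho> p) \<and>
          pairwise (\<lambda>p q. \<not> same_pair p q) P)"

text \<open>The rational points of the affine quartic model.  The leading coefficient \<open>-2\<close> is not a
  square in the rationals, so the smooth projective model has no further rational points.\<close>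

definition H_points :: "(rat \<times> rat) set" where
  "H_points = {(l, V). V\<^sup>2 = 9 - 21 * l\<^sup>2 - 18 * l ^ 3 - 2 * l ^ 4}"

text \<open>No rational point of the curve has \<open>l = 3\<close> (the right-hand side is negative there), so the
  denominator never vanishes where \<open>X_ell\<close> is used.\<close>

definition X_ell :: "rat \<Rightarrow> rat" where
  "X_ell l = 4 * l * (l + 1) * (l + 3) / ((3 - l) * (l\<^sup>2 + 3))"

definition rho_ell :: "rat \<Rightarrow> rat" where
  "rho_ell l = (4 - (X_ell l)\<^sup>2) / (4 + (X_ell l)\<^sup>2)"

end

theory Submission
  imports Defs "HOL-Library.Multiset" "HOL-Computational_Algebra.Polynomial"
begin

text \<open>
  Scale every triangle to semiperimeter \<open>1\<close>. If \<open>x, y, z\<close> are the differences between the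
  semiperimeter and the three sides, then \<open>x + y + z = 1\<close>, the angle opposite to the side
  \<open>1 - x\<close> has half-angle tangent \<open>h\<close> exactly when \<open>y z = h\<^sup>2 x\<close>, and then the area is
  \<open>h x\<close>. The isosceles triangle with height \<open>w\<close> and semiperimeter \<open>1\<close> has base \<open>1 - w\<^sup>2\<close>
  and legs \<open>(1 + w\<^sup>2) / 2\<close>; its area is \<open>w (1 - w\<^sup>2) / 2\<close>. So a pair for the angle
  \<open>2 arctan h\<close> amounts to rational numbers \<open>w\<close> in \<open>(0, 1)\<close> and \<open>x, y, z > 0\<close> with
  \<open>x + y + z = 1\<close>, \<open>y z = h\<^sup>2 x\<close> and \<open>2 h x = w (1 - w\<^sup>2)\<close>. The two triangles are congruent
  only if \<open>w = h\<close> or \<open>x = w\<^sup>2\<close>, and different \<open>w\<close> give different pairs.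

  The substitution \<open>\<lambda> = (3 u - 1) / (u + 1)\<close>, \<open>V = 2 v / (u + 1)\<^sup>2\<close> turns the curve
  \<open>\<H>\<close> into the Jacobi quartic \<open>v\<^sup>2 = 1 + 78 u\<^sup>2 - 207 u\<^sup>4\<close>, on which the involution
  \<open>\<lambda> \<mapsto> (\<lambda> + 3) / (\<lambda> - 1)\<close>, under which \<open>X\<close> changes sign, is just \<open>u \<mapsto> - u\<close>. With
  \<open>q = 3 u\<^sup>2 + 1\<close> the half-angle tangent is \<open>h = X / 2 = u (9 u\<^sup>2 - 1) / q\<close>. Four heights \<open>w\<close> are
  available. Two of them, \<open>(1 - u) (3 u + 1) / q\<close> and \<open>(3 u - 1) (u + 1) / q\<close>, exist for every
  rational \<open>u\<close> and share the first triangle: together with minus their sum they are the three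
  roots of a cubic \<open>w - w\<^sup>3 = const\<close>. The other two are the roots of
  \<open>6 u w\<^sup>2 - q w + 3 u (3 u\<^sup>2 - 1) = 0\<close>, whose discriminant is
  \<open>q\<^sup>2 - 72 u\<^sup>2 (3 u\<^sup>2 - 1) = 1 + 78 u\<^sup>2 - 207 u\<^sup>4\<close>; they are rational because \<open>(u, v)\<close> lies on the
  curve. All four lie in \<open>(0, 1)\<close> for points of the curve with \<open>u > 0\<close> and \<open>u\<^sup>2 > 1 / 3\<close>.

  It remains to find infinitely many rational points with \<open>u\<^sup>2 > 1 / 3\<close>. The curve carries
  Euler's addition law. Doubling a point whose abscissa is even at the prime \<open>2\<close> raises the
  \<open>2\<close>-adic valuation of the abscissa by one, which yields infinitely many abscissae
  (\<open>infinite_jacobi_abscissae\<close>). On the real locus, adding the point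
  \<open>(5 / 81, 2488 / 2187)\<close> is a rotation by a small step: if \<open>v \<ge> 0\<close>, it increases every
  abscissa \<open>u \<ge> 0\<close> with \<open>u\<^sup>2 \<le> 1 / 3\<close> by at least \<open>1 / 50\<close>, while all abscissae are less than
  \<open>1\<close>. If only finitely many had \<open>u\<^sup>2 > 1 / 3\<close>, then infinitely many could be pushed to the right
  for ever, which is absurd (\<open>infinite_jacobi_abscissae_outer\<close>). Distinct \<open>u\<close> in this range
  give distinct angles because \<open>h\<close> is strictly increasing there.
\<close>

section \<open>Triangles with semiperimeter one\<close>

fun sides :: "triangle \<Rightarrow> real multiset" where
  "sides (A, B, C) = {#dist A B, dist B C, dist C A#}"

lemma perimeter_eq_sum_sides: "perimeter T = sum_mset (sides T)"
  by (cases T) (simp add: add.assoc)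

lemma sides_scale:
  assumes "\<mu> > 0"
  shows "sides (scale \<mu> T) = image_mset (\<lambda>s. \<mu> * s) (sides T)"
  using assms by (cases T) (simp add: dist_norm flip: scaleR_diff_right)

lemma nondegenerate_distinct:
  assumes "nondegenerate (A, B, C)"
  shows "A \<noteq> B" "B \<noteq> C" "C \<noteq> A"
  using assms by (auto simp: nondegenerate_def insert_commute collinear_2)

text \<open>An isometry is injective, so it matches the three vertices in one of six ways; the side
  lengths are a multiset because the matching is not known in advance.\<close>

lemma congruent_imp_sides_eq:
  assumes "congruent_triangles T T'" "nondegenerate T"
  shows "sides T = sides T'"
proof -
  obtain A B C A' B' C' where T: "T = (A, B, C)" "T' = (A', B', C')"
    by (metis prod_cases3)
  obtain f where f: "\<And>x y. dist (f x) (f y) = dist x y" "f ` {A, B, C} = {A', B', C'}"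
    using assms(1) unfolding congruent_triangles_def T by auto
  have inj: "inj f"
    by (metis f(1) dist_eq_0_iff injI)
  have "f A \<noteq> f B" "f B \<noteq> f C" "f C \<noteq> f A"
    using nondegenerate_distinct assms(2) inj unfolding T by (meson injD)+
  moreover have "{f A, f B, f C} = {A', B', C'}"
    using f(2) by simp
  ultimately have "(f A, f B, f C) \<in> {(A', B', C'), (A', C', B'), (B', A', C'), (B', C', A'),
      (C', A', B'), (C', B', A')}"
    by (smt (verit, del_insts) insert_iff empty_iff)
  then have "{#dist (f A) (f B), dist (f B) (f C), dist (f C) (f A)#} = sides T'"
    unfolding T by (auto simp: dist_commute add_mset_commute)
  then show ?thesis
    unfolding T by (simp add: f(1))
qed

text \<open>This locates the base of an isosceles triangle among the sides of a congruent one.\<close>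

lemma mset_eq_triple_pairD:
  "{#a, b, c#} = {#p, v, v#} \<Longrightarrow>
    a = p \<and> b = v \<and> c = v \<or> b = p \<and> c = v \<and> a = v \<or> c = p \<and> a = v \<and> b = v"
proof -
  assume eq: "{#a, b, c#} = {#p, v, v#}"
  have pair: "s = v \<and> t = v" if "{#s, t#} = {#v, v#}" for s t
  proof -
    have "set_mset {#s, t#} = {v}"
      unfolding that by simp
    then show ?thesis
      by auto
  qed
  have "p \<in># {#a, b, c#}"
    unfolding eq by simp
  then consider "p = a" | "p = b" | "p = c"
    by auto
  then show ?thesis
  proof cases
    case 1
    then have "{#b, c#} = {#v, v#}"
      using eq by simp
    then show ?thesis
      using 1 pair by blast
  next
    case 2
    then have "{#a, c#} = {#v, v#}"
      using eq by (simp add: add_mset_commute)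
    then show ?thesis
      using 2 pair by blast
  next
    case 3
    then have "{#a, b#} = {#v, v#}"
      using eq by (simp add: add_mset_commute)
    then show ?thesis
      using 3 pair by blast
  qed
qed

definition base_apex :: "real \<Rightarrow> real \<Rightarrow> real \<Rightarrow> triangle" where
  "base_apex c p q = (vector [0, 0], vector [c, 0], vector [p, q])"

lemma norm_vector_2: "norm (vector [a, b] :: real^2) = sqrt (a\<^sup>2 + b\<^sup>2)"
  by (simp add: norm_vec_def L2_set_def sum_2)

lemma vector_2_diff: "vector [a, b] - vector [c, d] = (vector [a - c, b - d] :: real^2)"
  by (simp add: vec_eq_iff forall_2)

lemma sides_base_apex:
  assumes "c > 0"
  shows "sides (base_apex c p q) = {#c, sqrt ((c - p)\<^sup>2 + q\<^sup>2), sqrt (p\<^sup>2 + q\<^sup>2)#}"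
  using assms by (simp add: base_apex_def dist_norm vector_2_diff norm_vector_2)

lemma area_base_apex:
  assumes "c > 0" "q > 0"
  shows "area (base_apex c p q) = c * q / 2"
  using assms by (simp add: base_apex_def area_def content_triangle)

lemma nondegenerate_base_apex:
  assumes "c > 0" "q > 0"
  shows "nondegenerate (base_apex c p q)"
proof -
  have "vector [0, 0] = (0 :: real^2)"
    by (simp add: vec_eq_iff forall_2)
  moreover have "vector [c, 0] \<noteq> (0 :: real^2)" "vector [p, q] \<noteq> (0 :: real^2)"
    "vector [p, q] \<noteq> r *\<^sub>R (vector [c, 0] :: real^2)" for r
    using assms by (auto simp: vec_eq_iff forall_2)
  ultimately show ?thesis
    by (auto simp: nondegenerate_def base_apex_def collinear_lemma)
qed

lemma has_angle_base_apex:
  assumes "c > 0" "q > 0"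
  shows "has_angle (base_apex c p q) (arccos (p / sqrt (p\<^sup>2 + q\<^sup>2)))"
proof -
  have "angle (vector [p, q]) (vector [0, 0]) (vector [c, 0]) = arccos (p / sqrt (p\<^sup>2 + q\<^sup>2))"
    using assms by (simp add: angle_def vector_2_diff norm_vector_2 inner_vec_def sum_2)
  then show ?thesis
    unfolding base_apex_def by simp
qed

lemma rational_sides_iff: "rational_sides T \<longleftrightarrow> set_mset (sides T) \<subseteq> \<rat>"
  by (cases T) auto

text \<open>The argument is the height over the base. Since
  \<open>((1 - w\<^sup>2) / 2)\<^sup>2 + w\<^sup>2 = ((1 + w\<^sup>2) / 2)\<^sup>2\<close>, a rational height gives rational legs.\<close>

definition isosceles_tri :: "real \<Rightarrow> triangle" where
  "isosceles_tri w = base_apex (1 - w\<^sup>2) ((1 - w\<^sup>2) / 2) w"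

context
  fixes w :: real
  assumes w: "0 < w" "w < 1"
begin

lemma one_minus_sq_pos: "1 - w\<^sup>2 > 0"
  using w by (simp add: power_less_one_iff)

lemma sides_isosceles_tri:
  "sides (isosceles_tri w) = {#1 - w\<^sup>2, (1 + w\<^sup>2) / 2, (1 + w\<^sup>2) / 2#}"
proof -
  have "((1 - w\<^sup>2) / 2)\<^sup>2 + w\<^sup>2 = ((1 + w\<^sup>2) / 2)\<^sup>2"
    by (simp add: field_simps power2_eq_square)
  then have leg: "sqrt (((1 - w\<^sup>2) / 2)\<^sup>2 + w\<^sup>2) = (1 + w\<^sup>2) / 2"
    by (simp only:) (rule real_sqrt_unique, auto intro!: divide_nonneg_pos add_nonneg_nonneg)
  have half: "c - c / 2 = c / 2" for c :: real
    by simp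
  show ?thesis
    unfolding isosceles_tri_def sides_base_apex[OF one_minus_sq_pos] half leg ..
qed

lemma isosceles_isosceles_tri: "isosceles (isosceles_tri w)"
proof -
  have half: "c - c / 2 = c / 2" for c :: real
    by simp
  show ?thesis
    unfolding isosceles_tri_def base_apex_def isosceles.simps dist_norm vector_2_diff norm_vector_2
      half by (simp only: diff_0_right diff_0 power2_minus simp_thms)
qed

lemma nondegenerate_isosceles_tri: "nondegenerate (isosceles_tri w)"
  using one_minus_sq_pos w by (simp add: isosceles_tri_def nondegenerate_base_apex)

lemma area_isosceles_tri: "area (isosceles_tri w) = w * (1 - w\<^sup>2) / 2"
  using one_minus_sq_pos w by (simp add: isosceles_tri_def area_base_apex)

lemma perimeter_isosceles_tri: "perimeter (isosceles_tri w) = 2"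
  by (simp add: perimeter_eq_sum_sides sides_isosceles_tri)

end

text \<open>All these triangles have perimeter \<open>2\<close>, which forces the scaling factor to be \<open>1\<close>, and then
  the base determines \<open>w\<close>. Hence the heights alone tell pairs apart up to homothety.\<close>

lemma isosceles_tri_similar_imp_eq:
  assumes "0 < w" "w < 1" "0 < w'" "w' < 1" "\<mu> > 0"
    and "congruent_triangles (isosceles_tri w') (scale \<mu> (isosceles_tri w))"
  shows "w = w'"
proof -
  have eq: "sides (isosceles_tri w') = image_mset (\<lambda>s. \<mu> * s) (sides (isosceles_tri w))"
    using assms by (metis congruent_imp_sides_eq nondegenerate_isosceles_tri sides_scale)
  then have "sum_mset (sides (isosceles_tri w')) = \<mu> * sum_mset (sides (isosceles_tri w))"
    using sum_mset_distrib_left[of \<mu> "\<lambda>s. s" "sides (isosceles_tri w)"] by simp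
  then have "\<mu> = 1"
    using assms by (simp add: perimeter_isosceles_tri flip: perimeter_eq_sum_sides)
  then have "{#1 - w'\<^sup>2, (1 + w'\<^sup>2) / 2, (1 + w'\<^sup>2) / 2#} = {#1 - w\<^sup>2, (1 + w\<^sup>2) / 2, (1 + w\<^sup>2) / 2#}"
    using eq assms by (simp add: sides_isosceles_tri)
  then have "w\<^sup>2 = w'\<^sup>2"
    using mset_eq_triple_pairD[of "1 - w'\<^sup>2"] by (smt (verit, best))
  then show ?thesis
    using assms by simp
qed

text \<open>The first triangle is drawn with the prescribed angle at the origin, between sides of length
  \<open>x + y\<close> and \<open>x + z\<close>. From \<open>x + y + z = 1\<close> and \<open>y z = h\<^sup>2 x\<close> one gets
  \<open>(x + y) (x + z) = x (1 + h\<^sup>2)\<close>; this single identity makes the third side equal to \<open>y + z\<close>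
  (law of cosines) and the area equal to \<open>h x\<close>.

  A congruence would identify the side \<open>y + z\<close> with the base, so that \<open>x = w\<^sup>2\<close>, or with a leg,
  so that \<open>y z = w\<^sup>2 x\<close> and \<open>w = h\<close>. The last two hypotheses exclude these cases.\<close>

lemma genuine_pair_from_parameters:
  fixes h w x y z :: real and \<rho> :: rat
  assumes rat: "h \<in> \<rat>" "w \<in> \<rat>" "x \<in> \<rat>" "y \<in> \<rat>" "z \<in> \<rat>"
    and \<rho>: "of_rat \<rho> = (1 - h\<^sup>2) / (1 + h\<^sup>2)"
    and h: "h > 0" and w: "0 < w" "w < 1"
    and xyz: "x > 0" "y > 0" "z > 0" "x + y + z = 1"
    and ang: "y * z = h\<^sup>2 * x" and ar: "2 * h * x = w * (1 - w\<^sup>2)"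
    and ne: "w \<noteq> h" "2 * h * w \<noteq> 1 - w\<^sup>2"
  shows "\<exists>T. genuine_pair \<rho> (T, isosceles_tri w)"
proof -
  \<comment> \<open>the cosine and the sine of the angle with half-angle tangent \<open>h\<close>\<close>
  define r where "r = (1 - h\<^sup>2) / (1 + h\<^sup>2)"
  define s where "s = 2 * h / (1 + h\<^sup>2)"
  define T where "T = base_apex (x + y) ((x + z) * r) ((x + z) * s)"
  have h1: "1 + h\<^sup>2 > 0"
    by (simp add: add_pos_nonneg)
  have rs: "r\<^sup>2 + s\<^sup>2 = 1"
  proof -
    have "r\<^sup>2 + s\<^sup>2 = ((1 - h\<^sup>2)\<^sup>2 + (2 * h)\<^sup>2) / (1 + h\<^sup>2)\<^sup>2"
      by (simp add: r_def s_def power_divide add_divide_distrib)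
    also have "(1 - h\<^sup>2)\<^sup>2 + (2 * h)\<^sup>2 = (1 + h\<^sup>2)\<^sup>2"
      by (simp add: power2_eq_square algebra_simps)
    finally show ?thesis
      using h1 by simp
  qed
  have s: "s > 0"
    using h h1 by (simp add: s_def)
  have prod: "(x + y) * (x + z) = x * (1 + h\<^sup>2)"
  proof -
    have "(x + y) * (x + z) = x * (x + y + z) + y * z"
      by (simp add: algebra_simps)
    then show ?thesis
      unfolding xyz(4) using ang by (simp add: algebra_simps)
  qed
  have pq: "((x + z) * r)\<^sup>2 + ((x + z) * s)\<^sup>2 = (x + z)\<^sup>2"
    using rs by (metis distrib_left mult.right_neutral power_mult_distrib)
  have third: "(x + y - (x + z) * r)\<^sup>2 + ((x + z) * s)\<^sup>2 = (y + z)\<^sup>2"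
  proof -
    have "(x + y) * (x + z) * r = x * ((1 + h\<^sup>2) * r)"
      using prod by simp
    also have "(1 + h\<^sup>2) * r = 1 - h\<^sup>2"
      using h1 by (simp add: r_def)
    also have "x * (1 - h\<^sup>2) = x * (x + y + z) - y * z"
      using ang xyz(4) by (simp add: algebra_simps)
    finally have "(x + y) * (x + z) * r = x * (x + y + z) - y * z" .
    then show ?thesis
      using pq by (simp add: power2_eq_square algebra_simps)
  qed
  have sidesT: "sides T = {#x + y, y + z, x + z#}"
    using xyz by (simp add: T_def sides_base_apex pq third)
  have areaT: "area T = w * (1 - w\<^sup>2) / 2"
  proof -
    have "area T = ((x + y) * (x + z)) * s / 2"
      using xyz s by (simp add: T_def area_base_apex)
    also have "\<dots> = h * x"
      using h1 by (simp add: prod s_def)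
    finally show ?thesis
      using ar by simp
  qed
  have nondegT: "nondegenerate T"
    using xyz s by (simp add: T_def nondegenerate_base_apex)
  have "rational_triangle T"
    using nondegT rat by (simp add: rational_triangle_def rational_sides_iff sidesT)
  moreover have "rational_triangle (isosceles_tri w)"
    using rat w by (simp add: rational_triangle_def rational_sides_iff sides_isosceles_tri
        nondegenerate_isosceles_tri)
  moreover have "\<exists>\<theta>. 0 < \<theta> \<and> \<theta> < pi \<and> cos \<theta> = of_rat \<rho> \<and> has_angle T \<theta>"
  proof -
    have "0 < s\<^sup>2"
      using s by simp
    then have "\<bar>r\<bar> < 1"
      using rs abs_square_less_1[of r] by linarith
    then have r: "-1 < r" "r < 1"
      by auto
    have "has_angle T (arccos r)"
      using has_angle_base_apex[of "x + y" "(x + z) * s" "(x + z) * r"] xyz s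
      by (simp add: T_def pq)
    moreover have "0 < arccos r" "arccos r < pi"
      using r arccos_lt_bounded by auto
    moreover have "cos (arccos r) = of_rat \<rho>"
      using r by (simp add: \<rho> flip: r_def)
    ultimately show ?thesis
      by blast
  qed
  moreover have "perimeter T = perimeter (isosceles_tri w)"
    using xyz(4) w by (simp add: perimeter_isosceles_tri perimeter_eq_sum_sides[of T] sidesT)
  moreover have "\<not> congruent_triangles T (isosceles_tri w)"
  proof
    assume "congruent_triangles T (isosceles_tri w)"
    then have *: "{#x + y, y + z, x + z#} = {#1 - w\<^sup>2, (1 + w\<^sup>2) / 2, (1 + w\<^sup>2) / 2#}"
      using congruent_imp_sides_eq[OF _ nondegT] by (simp add: sidesT sides_isosceles_tri[OF w])
    have base: False if "x = w\<^sup>2"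
    proof -
      have "w * (2 * h * w) = w * (1 - w\<^sup>2)"
        using ar that by (simp add: power2_eq_square mult_ac)
      then show False
        using ne(2) w(1) by simp
    qed
    have leg: False if "y * z = w\<^sup>2 * x"
    proof -
      have "w\<^sup>2 = h\<^sup>2"
        using ang that xyz(1) by simp
      then show False
        using ne(1) w(1) h by (simp add: power2_eq_iff_nonneg)
    qed
    show False
      using mset_eq_triple_pairD[OF *]
    proof (elim disjE conjE)
      assume a: "x + y = 1 - w\<^sup>2" "y + z = (1 + w\<^sup>2) / 2" "x + z = (1 + w\<^sup>2) / 2"
      then have "z = w\<^sup>2" "y = x"
        using xyz(4) by linarith+
      then show False
        using leg by simp
    next
      assume "y + z = 1 - w\<^sup>2"
      then show False
        using base xyz(4) by linarith
    next
      assume a: "x + z = 1 - w\<^sup>2" "x + y = (1 + w\<^sup>2) / 2" "y + z = (1 + w\<^sup>2) / 2"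
      then have "y = w\<^sup>2" "z = x"
        using xyz(4) by linarith+
      then show False
        using leg by simp
    qed
  qed
  ultimately have "genuine_pair \<rho> (T, isosceles_tri w)"
    using w areaT by (simp add: genuine_pair_def isosceles_isosceles_tri area_isosceles_tri)
  then show ?thesis
    by blast
qed

lemma at_least_distinct_if_genuine_pairs:
  assumes "finite W" "card W = n" "\<And>w. w \<in> W \<Longrightarrow> 0 < w \<and> w < 1"
    and "\<And>w. w \<in> W \<Longrightarrow> \<exists>T. genuine_pair \<rho> (T, isosceles_tri w)"
  shows "at_least_distinct_genuine_pairs n \<rho>"
proof -
  obtain T where T: "\<And>w. w \<in> W \<Longrightarrow> genuine_pair \<rho> (T w, isosceles_tri w)"
    using assms(4) by metis
  define F where "F = (\<lambda>w. (T w, isosceles_tri w))"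
  have "inj_on F W"
  proof (rule inj_onI)
    fix w w' assume ww: "w \<in> W" "w' \<in> W" "F w = F w'"
    then have "sides (isosceles_tri w) = sides (isosceles_tri w')"
      by (simp add: F_def)
    then have "{#1 - w\<^sup>2, (1 + w\<^sup>2) / 2, (1 + w\<^sup>2) / 2#} = {#1 - w'\<^sup>2, (1 + w'\<^sup>2) / 2, (1 + w'\<^sup>2) / 2#}"
      using ww assms(3) by (simp add: sides_isosceles_tri)
    then have "w\<^sup>2 = w'\<^sup>2"
      using mset_eq_triple_pairD by (smt (verit, best))
    then show "w = w'"
      using assms(3) ww by (simp add: order_less_imp_le)
  qed
  then have "card (F ` W) = n"
    using assms(2) by (simp add: card_image)
  moreover have "pairwise (\<lambda>p q. \<not> same_pair p q) (F ` W)"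
  proof (rule pairwiseI)
    fix p q assume "p \<in> F ` W" "q \<in> F ` W" "p \<noteq> q"
    then obtain w w' where ww: "w \<in> W" "p = F w" "w' \<in> W" "q = F w'" "w \<noteq> w'"
      by blast
    then have "\<not> congruent_triangles (isosceles_tri w') (scale \<mu> (isosceles_tri w))" if "\<mu> > 0" for \<mu>
      using isosceles_tri_similar_imp_eq that assms(3) by metis
    then show "\<not> same_pair p q"
      by (auto simp: F_def same_pair_def ww)
  qed
  ultimately show ?thesis
    unfolding at_least_distinct_genuine_pairs_def
    using assms(1) T by (intro exI[of _ "F ` W"]) (auto simp: F_def)
qed

text \<open>The triangles enter the arithmetic only through these rational parameters: \<open>w\<close> is the
  height of the isosceles triangle, and \<open>x, y, z\<close> are the distances from the vertices of the
  other triangle to the points where its incircle touches the sides.\<close>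

definition pair_parameters :: "rat \<Rightarrow> rat \<Rightarrow> bool" where
  "pair_parameters h w \<longleftrightarrow> 0 < w \<and> w < 1 \<and> w \<noteq> h \<and> 2 * h * w \<noteq> 1 - w\<^sup>2 \<and>
     (\<exists>x y z. 0 < x \<and> 0 < y \<and> 0 < z \<and> x + y + z = 1 \<and> y * z = h\<^sup>2 * x \<and> 2 * h * x = w * (1 - w\<^sup>2))"

lemma genuine_pair_if_pair_parameters:
  assumes "pair_parameters h w" "h > 0"
  shows "\<exists>T. genuine_pair ((1 - h\<^sup>2) / (1 + h\<^sup>2)) (T, isosceles_tri (of_rat w))"
proof -
  obtain x y z where xyz: "0 < x" "0 < y" "0 < z" "x + y + z = 1" "y * z = h\<^sup>2 * x"
      "2 * h * x = w * (1 - w\<^sup>2)" and w: "0 < w" "w < 1" "w \<noteq> h" "2 * h * w \<noteq> 1 - w\<^sup>2"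
    using assms(1) by (auto simp: pair_parameters_def)
  \<comment> \<open>The abbreviation keeps the simplifier from pushing \<open>of_rat\<close> through the
     terms before the equations between rationals have been transported.\<close>
  define R :: "rat \<Rightarrow> real" where "R = of_rat"
  have R: "R 1 = 1" "R 2 = 2" "R (a + b) = R a + R b" "R (a - b) = R a - R b" "R (a * b) = R a * R b"
    "R (a ^ n) = R a ^ n" "R (a / b) = R a / R b" for a b n
    by (simp_all add: R_def of_rat_add of_rat_diff of_rat_mult of_rat_power of_rat_divide)
  have pos: "0 < a \<Longrightarrow> 0 < R a" for a
    by (simp add: R_def)
  have inj: "R a = R b \<longleftrightarrow> a = b" for a b
    by (simp add: R_def)
  show ?thesis
    unfolding R_def[symmetric]
  proof (rule genuine_pair_from_parameters[of "R h" "R w" "R x" "R y" "R z"])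
    show "R w < 1"
      using w by (simp add: R_def)
    show "R x + R y + R z = 1"
      using xyz(4) by (metis R(1,3))
    show "R y * R z = (R h)\<^sup>2 * R x"
      using xyz(5) by (metis R(5,6))
    show "2 * R h * R x = R w * (1 - (R w)\<^sup>2)"
      using xyz(6) by (metis R(1,2,4,5,6))
    show "2 * R h * R w \<noteq> 1 - (R w)\<^sup>2"
      using w(4) inj by (metis R(1,2,4,5,6))
    show "of_rat ((1 - h\<^sup>2) / (1 + h\<^sup>2)) = (1 - (R h)\<^sup>2) / (1 + (R h)\<^sup>2)"
      unfolding R_def[symmetric] by (simp only: R)
    show "R w \<noteq> R h"
      using w(3) inj by simp
  qed (use assms w xyz pos in \<open>auto simp: R_def\<close>)
qed

section \<open>Rational points on a Jacobi quartic\<close>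

definition on_jacobi :: "rat \<Rightarrow> rat \<Rightarrow> bool" where
  "on_jacobi u v \<longleftrightarrow> v\<^sup>2 = 1 + 78 * u\<^sup>2 - 207 * u ^ 4"

text \<open>Euler's addition law for \<open>v\<^sup>2 = 1 + a u\<^sup>2 + b u\<^sup>4\<close>, here with \<open>a = 78\<close> and \<open>b = - 207\<close>;
  the neutral element is \<open>(0, 1)\<close>.\<close>

lemma on_jacobi_add:
  fixes c k u v :: rat
  assumes "on_jacobi c k" "on_jacobi u v" and d: "1 + 207 * c\<^sup>2 * u\<^sup>2 \<noteq> 0"
  shows "on_jacobi ((u * k + c * v) / (1 + 207 * c\<^sup>2 * u\<^sup>2))
    (((1 - 207 * c\<^sup>2 * u\<^sup>2) * (k * v + 78 * c * u) - 414 * c * u * (c\<^sup>2 + u\<^sup>2))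
      / (1 + 207 * c\<^sup>2 * u\<^sup>2)\<^sup>2)"
proof -
  define D where "D = 1 + 207 * c\<^sup>2 * u\<^sup>2"
  define A where "A = u * k + c * v"
  define B where "B = (1 - 207 * c\<^sup>2 * u\<^sup>2) * (k * v + 78 * c * u) - 414 * c * u * (c\<^sup>2 + u\<^sup>2)"
  have "B\<^sup>2 = D ^ 4 + 78 * A\<^sup>2 * D\<^sup>2 - 207 * A ^ 4"
    using assms(1,2) unfolding on_jacobi_def A_def B_def D_def by algebra
  moreover have "D \<noteq> 0"
    using d by (simp add: D_def)
  moreover have "(B / D\<^sup>2)\<^sup>2 = B\<^sup>2 / D ^ 4"
    by (simp add: power_divide flip: power_mult)
  moreover have "(A / D)\<^sup>2 = A\<^sup>2 * D\<^sup>2 / D ^ 4"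
    using \<open>D \<noteq> 0\<close> by (simp add: power_divide power2_eq_square power4_eq_xxxx)
  ultimately have "(B / D\<^sup>2)\<^sup>2 = 1 + 78 * (A / D)\<^sup>2 - 207 * (A / D) ^ 4"
    by (simp add: power_divide diff_divide_distrib add_divide_distrib)
  then show ?thesis
    unfolding on_jacobi_def A_def B_def D_def .
qed

text \<open>Doubling sends \<open>u\<close> to \<open>2 u v / (1 + 207 u\<^sup>4)\<close>. If \<open>u\<close> is divisible by \<open>2\<close>, then \<open>v\<close> and
  the denominator are \<open>2\<close>-adic units, so the valuation of \<open>u\<close> grows by exactly one. The first point
  has abscissa \<open>44 / 223\<close>; up to signs it arises from \<open>(1 / 3, 8 / 3)\<close> by doubling twice.\<close>

lemma on_jacobi_two_adic:
  "\<exists>a d e :: int. odd a \<and> odd d \<and> odd e \<and>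
     on_jacobi (of_int (2 ^ (n + 2) * a) / of_int d) (of_int e / (of_int d)\<^sup>2)"
proof (induction n)
  case 0
  have "on_jacobi (of_int (2 ^ (0 + 2) * 11) / of_int 223) (of_int (95951) / (of_int 223)\<^sup>2)"
    by (simp add: on_jacobi_def power_divide)
  then show ?case
    by (intro exI[of _ 11] exI[of _ 223] exI[of _ "95951"]) simp
next
  case (Suc n)
  then obtain a d e :: int where ade: "odd a" "odd d" "odd e"
    "on_jacobi (of_int (2 ^ (n + 2) * a) / of_int d) (of_int e / (of_int d)\<^sup>2)"
    by blast
  define b where "b = 2 ^ (n + 2) * a"
  define d' where "d' = d ^ 4 + 207 * b ^ 4"
  define e' where "e' = (d ^ 4 - 207 * b ^ 4) * (e\<^sup>2 + 78 * b\<^sup>2 * d\<^sup>2) - 828 * b ^ 4 * d ^ 4"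
  have d0: "(of_int d :: rat) \<noteq> 0"
    using ade(2) by auto
  have d'0: "(of_int d' :: rat) > 0"
    using d0 by (simp add: d'_def add_pos_nonneg)
  define U V :: rat where "U = of_int b / of_int d" and "V = of_int e / (of_int d)\<^sup>2"
  have UV: "on_jacobi U V"
    using ade(4) by (simp add: U_def V_def b_def)
  have D: "1 + 207 * U\<^sup>2 * U\<^sup>2 = of_int d' / of_int d ^ 4"
    using d0 by (simp add: U_def d'_def field_simps power2_eq_square power4_eq_xxxx)
  have D0: "1 + 207 * U\<^sup>2 * U\<^sup>2 \<noteq> 0"
    using d0 d'0 by (simp add: D)
  have "(U * V + U * V) / (1 + 207 * U\<^sup>2 * U\<^sup>2) = of_int (2 ^ (Suc n + 2) * (a * d * e)) / of_int d'"
    using d0 d'0 unfolding D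
    by (simp add: U_def V_def b_def field_simps power2_eq_square power4_eq_xxxx)
  moreover have "((1 - 207 * U\<^sup>2 * U\<^sup>2) * (V * V + 78 * U * U) - 414 * U * U * (U\<^sup>2 + U\<^sup>2))
      / (1 + 207 * U\<^sup>2 * U\<^sup>2)\<^sup>2 = of_int e' / (of_int d')\<^sup>2"
    using d0 d'0 unfolding D
    by (simp add: U_def V_def e'_def field_simps power2_eq_square power4_eq_xxxx)
  ultimately have "on_jacobi (of_int (2 ^ (Suc n + 2) * (a * d * e)) / of_int d') (of_int e' / (of_int d')\<^sup>2)"
    using on_jacobi_add[OF UV UV D0] by simp
  moreover have "odd (a * d * e)" "odd d'" "odd e'"
    using ade by (auto simp: d'_def e'_def b_def)
  ultimately show ?case
    by blast
qed

text \<open>Nonnegative abscissae suffice, as the curve is symmetric under \<open>u \<mapsto> - u\<close>.\<close>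

definition jacobi_abscissae :: "rat set" where
  "jacobi_abscissae = {u. 0 \<le> u \<and> (\<exists>v. on_jacobi u v)}"

lemma abs_in_jacobi_abscissae: "on_jacobi u v \<Longrightarrow> \<bar>u\<bar> \<in> jacobi_abscissae"
  by (auto simp: jacobi_abscissae_def on_jacobi_def intro!: exI[of _ v])

lemma jacobi_abscissa_square_less:
  assumes "on_jacobi u v"
  shows "u\<^sup>2 < 2 / 5"
proof (rule ccontr)
  assume "\<not> u\<^sup>2 < 2 / 5"
  then have "u\<^sup>2 * (u\<^sup>2 - 2/5) \<ge> 0" "u\<^sup>2 \<ge> 2/5"
    by (auto intro: mult_nonneg_nonneg)
  moreover have "v\<^sup>2 = 1 + 78 * u\<^sup>2 - 207 * (u\<^sup>2 * u\<^sup>2)"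
    using assms by (simp add: on_jacobi_def flip: power_add)
  then have "1 + 78 * u\<^sup>2 - 207 * (u\<^sup>2 * u\<^sup>2) \<ge> 0"
    by (metis zero_le_power2)
  ultimately show False
    by (simp add: algebra_simps)
qed

lemma infinite_jacobi_abscissae: "infinite jacobi_abscissae"
proof -
  obtain a d e :: "nat \<Rightarrow> int" where ade: "\<And>n. odd (a n)" "\<And>n. odd (d n)"
    "\<And>n. on_jacobi (of_int (2 ^ (n + 2) * a n) / of_int (d n)) (of_int (e n) / (of_int (d n))\<^sup>2)"
    using on_jacobi_two_adic by metis
  define U :: "nat \<Rightarrow> rat" where "U n = \<bar>of_int (2 ^ (n + 2) * a n) / of_int (d n)\<bar>" for n
  have "inj U"
  proof (rule linorder_injI)
    fix m n :: nat assume mn: "m < n"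
    show "U m \<noteq> U n"
    proof
      assume "U m = U n"
      moreover have "d m \<noteq> 0" "d n \<noteq> 0"
        using ade(2) by (metis even_zero)+
      ultimately have "(of_int \<bar>2 ^ (m + 2) * a m * d n\<bar> :: rat) = of_int \<bar>2 ^ (n + 2) * a n * d m\<bar>"
        by (simp add: U_def field_simps abs_mult)
      then have "\<bar>2 ^ (m + 2) * a m * d n\<bar> = \<bar>2 ^ (n + 2) * a n * d m\<bar>"
        using of_int_eq_iff by blast
      \<comment> \<open>different powers of \<open>2\<close> cannot be balanced by odd factors\<close>
      also have "(2::int) ^ (n + 2) = 2 ^ (m + 2) * 2 ^ (n - m)"
        using mn by (simp flip: power_add)
      finally have "\<bar>a m * d n\<bar> = 2 ^ (n - m) * \<bar>a n * d m\<bar>"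
        by (simp add: abs_mult)
      moreover have "odd \<bar>a m * d n\<bar>"
        using ade by simp
      ultimately show False
        using mn by simp
    qed
  qed
  moreover have "range U \<subseteq> jacobi_abscissae"
    unfolding U_def using abs_in_jacobi_abscissae[OF ade(3)] by blast
  ultimately show ?thesis
    using infinite_super range_inj_infinite by blast
qed

text \<open>The abscissa of \<open>(u, v) + (5 / 81, 2488 / 2187)\<close>. The added point is the difference of the
  points \<open>(1 / 2, 11 / 4)\<close> and \<open>(1 / 3, 8 / 3)\<close>; it is chosen because it is so close to the neutral
  element that the rotation it induces still moves \<open>u = 1 / \<surd>3\<close> to the right.\<close>

definition rotate_abscissa :: "rat \<Rightarrow> rat \<Rightarrow> rat" where
  "rotate_abscissa u v = (u * (2488 / 2187) + 5 / 81 * v) / (1 + 207 * (5 / 81)\<^sup>2 * u\<^sup>2)"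

lemma rotate_abscissa_in:
  assumes "on_jacobi u v" "u \<ge> 0" "v \<ge> 0"
  shows "rotate_abscissa u v \<in> jacobi_abscissae"
proof -
  have "on_jacobi (5 / 81) (2488 / 2187)"
    by (simp add: on_jacobi_def power_divide)
  moreover have D: "1 + 207 * (5 / 81)\<^sup>2 * u\<^sup>2 > 0"
    by (simp add: add_pos_nonneg)
  ultimately have "\<exists>v'. on_jacobi (rotate_abscissa u v) v'"
    using on_jacobi_add[OF _ assms(1), of "5 / 81" "2488 / 2187"] unfolding rotate_abscissa_def
    by (metis less_irrefl)
  moreover have "rotate_abscissa u v \<ge> 0"
    unfolding rotate_abscissa_def using assms D by (intro divide_nonneg_pos add_nonneg_nonneg) auto
  ultimately show ?thesis
    by (simp add: jacobi_abscissae_def)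
qed

text \<open>With \<open>t = u\<^sup>2\<close> the curve equation gives \<open>v \<ge> 1 + 3 t\<close> for \<open>t \<le> 1 / 3\<close>; the bound is sharp
  at both ends, where \<open>v = 1\<close> and \<open>v = 2\<close>. It makes the claim linear in \<open>u\<close>, \<open>t\<close> and \<open>t u\<close>.\<close>

lemma rotate_abscissa_gain:
  assumes "on_jacobi u v" "u \<ge> 0" "v \<ge> 0" "u\<^sup>2 \<le> 1 / 3"
  shows "u + 1 / 50 \<le> rotate_abscissa u v"
proof -
  define t where "t = u\<^sup>2"
  have t: "0 \<le> t" "t \<le> 1 / 3"
    using assms by (auto simp: t_def)
  have v: "v \<ge> 1 + 3 * t"
  proof (rule power2_le_imp_le)
    have "v\<^sup>2 - (1 + 3 * t)\<^sup>2 = 72 * t * (1 - 3 * t)"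
      using assms(1) by (simp add: on_jacobi_def t_def power2_eq_square power4_eq_xxxx algebra_simps)
    also have "\<dots> \<ge> 0"
      using t by simp
    finally show "(1 + 3 * t)\<^sup>2 \<le> v\<^sup>2"
      by simp
  qed (use assms in auto)
  have u: "u \<le> 3 / 5"
  proof (rule power2_le_imp_le)
    show "u\<^sup>2 \<le> (3 / 5)\<^sup>2"
      using assms(4) by (simp add: power2_eq_square)
  qed simp
  have D: "1 + 575 / 729 * t > 0"
    using t by simp
  have "(u + 1 / 50) * (1 + 575 / 729 * t) \<le> u * (2488 / 2187) + 5 / 81 * (1 + 3 * t)"
  proof -
    have tu: "t \<le> 3 / 5 * u"
      using mult_right_mono[OF u assms(2)] by (simp add: t_def power2_eq_square)
    have "5 * (t * u) \<le> 3 * t"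
      using mult_left_mono[OF u t(1)] by simp
    \<comment> \<open>\<open>109350\<close> is the least common denominator of all the coefficients\<close>
    then have "109350 * u + 2187 + 1725 * t + 86250 * (t * u) \<le> 124400 * u + 6750 + 20250 * t"
      using tu u by linarith
    moreover have "109350 * ((u + 1 / 50) * (1 + 575 / 729 * t)) = 109350 * u + 2187 + 1725 * t + 86250 * (t * u)"
      by (simp add: field_simps)
    moreover have "109350 * (u * (2488 / 2187) + 5 / 81 * (1 + 3 * t)) = 124400 * u + 6750 + 20250 * t"
      by (simp add: field_simps)
    ultimately have "109350 * ((u + 1 / 50) * (1 + 575 / 729 * t))
        \<le> 109350 * (u * (2488 / 2187) + 5 / 81 * (1 + 3 * t))"
      by (simp only:)
    then show ?thesis
      by (rule mult_left_le_imp_le) simp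
  qed
  also have "\<dots> \<le> u * (2488 / 2187) + 5 / 81 * v"
    using v by simp
  finally show ?thesis
    using D by (simp add: rotate_abscissa_def t_def pos_le_divide_eq power_divide)
qed

text \<open>Eliminating \<open>v\<close> from \<open>rotate_abscissa u v = r\<close> leaves a polynomial equation of degree \<open>4\<close>
  for \<open>u\<close>, whose leading coefficient is a square plus a positive number.\<close>

lemma rotate_abscissa_finite_fibre: "finite {u. \<exists>v. on_jacobi u v \<and> rotate_abscissa u v = r}"
proof -
  define c k :: rat where "c = 5 / 81" and "k = 2488 / 2187"
  define g where "g = 207 * c\<^sup>2"
  define p where "p = [:r, 0, r * g:] - [:0, k:]"
  define P where "P = p * p - smult (c\<^sup>2) [:1, 0, 78, 0, -207:]"
  have "poly P u = 0" if uv: "on_jacobi u v" "rotate_abscissa u v = r" for u v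
  proof -
    have "1 + g * u\<^sup>2 > 0"
      by (simp add: g_def add_pos_nonneg)
    then have "c * v = poly p u"
      using uv(2) by (auto simp: rotate_abscissa_def p_def g_def c_def k_def field_simps power2_eq_square)
    then have "(poly p u)\<^sup>2 = c\<^sup>2 * v\<^sup>2"
      by (metis power_mult_distrib)
    also have "v\<^sup>2 = poly [:1, 0, 78, 0, -207:] u"
      using uv(1) by (simp add: on_jacobi_def power2_eq_square power4_eq_xxxx algebra_simps)
    finally show ?thesis
      by (simp only: P_def poly_diff poly_mult poly_smult power2_eq_square)
  qed
  moreover have "P \<noteq> 0"
  proof
    assume "P = 0"
    then have "coeff P 4 = 0"
      by simp
    moreover have "coeff P 4 = (r * g)\<^sup>2 + 207 * c\<^sup>2"
      by (simp add: P_def p_def numeral_eq_Suc)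
    moreover have "207 * c\<^sup>2 > 0"
      by (simp add: c_def)
    ultimately show False
      using zero_le_power2[of "r * g"] by linarith
  qed
  ultimately show ?thesis
    by (intro finite_subset[OF _ poly_roots_finite[of P]]) auto
qed

text \<open>If only finitely many abscissae had \<open>u\<^sup>2 > 1 / 3\<close>, then infinitely many abscissae to the
  right of \<open>n / 50\<close> could be rotated to the right of \<open>(n + 1) / 50\<close>. At \<open>n = 50\<close> this contradicts
  the bound \<open>u\<^sup>2 < 2 / 5\<close>.\<close>

lemma infinite_jacobi_abscissae_outer: "infinite {u \<in> jacobi_abscissae. 1 / 3 < u\<^sup>2}"
proof
  assume fin: "finite {u \<in> jacobi_abscissae. 1 / 3 < u\<^sup>2}"
  have "infinite {u \<in> jacobi_abscissae. of_nat n / 50 \<le> u}" for n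
  proof (induction n)
    case 0
    have "{u \<in> jacobi_abscissae. of_nat 0 / 50 \<le> u} = jacobi_abscissae"
      by (auto simp: jacobi_abscissae_def)
    then show ?case
      using infinite_jacobi_abscissae by simp
  next
    case (Suc n)
    define A where "A = {u \<in> jacobi_abscissae. of_nat n / 50 \<le> u \<and> u\<^sup>2 \<le> 1 / 3}"
    have "{u \<in> jacobi_abscissae. of_nat n / 50 \<le> u} \<subseteq> A \<union> {u \<in> jacobi_abscissae. 1 / 3 < u\<^sup>2}"
      by (auto simp: A_def)
    then have infA: "infinite A"
      using Suc fin by (metis finite_UnI finite_subset)
    have "\<exists>v. on_jacobi u v \<and> 0 \<le> v" if "u \<in> A" for u
    proof -
      obtain v where "on_jacobi u v"
        using \<open>u \<in> A\<close> by (auto simp: A_def jacobi_abscissae_def)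
      then show ?thesis
        by (intro exI[of _ "\<bar>v\<bar>"]) (simp add: on_jacobi_def)
    qed
    then obtain v where v: "\<And>u. u \<in> A \<Longrightarrow> on_jacobi u (v u) \<and> 0 \<le> v u"
      by metis
    define F where "F u = rotate_abscissa u (v u)" for u
    have "finite {u \<in> A. F u = r}" for r
      using v by (intro finite_subset[OF _ rotate_abscissa_finite_fibre[of r]]) (auto simp: F_def)
    then have "infinite (F ` A)"
      using infA pigeonhole_infinite[of A F] by auto
    moreover have "F ` A \<subseteq> {u \<in> jacobi_abscissae. of_nat (Suc n) / 50 \<le> u}"
    proof
      fix r assume "r \<in> F ` A"
      then obtain u where u: "u \<in> A" "r = F u"
        by blast
      then have "0 \<le> u" "u\<^sup>2 \<le> 1 / 3" "of_nat n / 50 \<le> u"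
        by (auto simp: A_def jacobi_abscissae_def)
      then show "r \<in> {u \<in> jacobi_abscissae. of_nat (Suc n) / 50 \<le> u}"
        using rotate_abscissa_in[of u "v u"] rotate_abscissa_gain[of u "v u"] v[OF u(1)]
        by (simp add: u(2) F_def add_divide_distrib)
    qed
    ultimately show ?case
      using infinite_super by blast
  qed
  from this[of 50] obtain u where "u \<in> jacobi_abscissae" "1 \<le> u"
    using not_finite_existsD by (metis (mono_tags, lifting) numeral_One of_nat_numeral divide_self_if zero_neq_numeral)
  then have "u\<^sup>2 < 2 / 5"
    using jacobi_abscissa_square_less by (auto simp: jacobi_abscissae_def)
  moreover have "1 \<le> u\<^sup>2"
    using \<open>1 \<le> u\<close> by (rule one_le_power)
  ultimately show False
    by simp
qed

section \<open>Four pairs over each point of the curve\<close>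

text \<open>This is \<open>X / 2\<close> in terms of the coordinate \<open>u\<close>; see \<open>quartic_point\<close> below.\<close>

definition half_angle_tan :: "rat \<Rightarrow> rat" where
  "half_angle_tan u = u * (9 * u\<^sup>2 - 1) / (3 * u\<^sup>2 + 1)"

text \<open>The arc of the curve on which all four heights lie strictly between \<open>0\<close> and \<open>1\<close>. At its
  boundary \<open>u\<^sup>2 = 1 / 3\<close> the pairs degenerate: three of the heights coincide with \<open>h\<close> and the fourth
  vanishes. This is why \<open>3 t - 1\<close> is a factor of most of the expressions whose vanishing is excluded below.\<close>

locale good_point =
  fixes u v :: rat
  assumes on_curve: "on_jacobi u v" and u0: "u \<ge> 0" and u_sq: "1 / 3 < u\<^sup>2" and v0: "v \<ge> 0"
begin

definition "t = u\<^sup>2"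
definition "q = 3 * t + 1"

lemma t_bounds: "1 / 3 < t" "t < 2 / 5"
  using u_sq jacobi_abscissa_square_less[OF on_curve] by (auto simp: t_def)

lemma u_bounds: "1 / 2 < u" "u < 2 / 3"
proof -
  have "(1/2)\<^sup>2 < u\<^sup>2" "u\<^sup>2 < (2/3)\<^sup>2"
    using t_bounds by (auto simp: t_def power2_eq_square)
  then show "1/2 < u" "u < 2/3"
    using power2_less_imp_less[of "1/2" u] power2_less_imp_less[of u "2/3"] u0 by auto
qed

lemma q_bounds: "2 < q" "q < 11 / 5"
  using t_bounds by (auto simp: q_def)

lemma uu: "u * u = t"
  by (simp add: t_def power2_eq_square)

abbreviation "h \<equiv> half_angle_tan u"

lemma h_eq: "h * q = u * (9 * t - 1)"
  using q_bounds by (simp add: half_angle_tan_def q_def t_def)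

lemma h_pos: "h > 0"
  using u_bounds t_bounds by (simp add: half_angle_tan_def t_def)

lemma h_gt: "u < h"
proof -
  have "u * q < h * q"
    unfolding h_eq using u_bounds t_bounds by (simp add: q_def)
  then show ?thesis
    using q_bounds by simp
qed

text \<open>The triangle is the same for both heights \<open>w = A / q\<close>, because its parameters \<open>x, y, z\<close> depend
  on \<open>u\<close> alone.\<close>

lemma pair_parameters_shared_triangle:
  assumes w: "0 < w" "w < 1"
    and A: "w * q = A" "A * (q\<^sup>2 - A\<^sup>2) = 4 * u * (9 * t - 1) * (1 - t)"
    and ne: "A \<noteq> u * (9 * t - 1)" "2 * u * (9 * t - 1) * A \<noteq> q\<^sup>2 - A\<^sup>2"
  shows "pair_parameters h w"
proof -
  define x y z where "x = 2 * (1 - t) / q\<^sup>2" and "y = 2 * t * (9 * t - 1) / q\<^sup>2"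
    and "z = (1 - t) * (9 * t - 1) / q\<^sup>2"
  have q0: "q \<noteq> 0"
    using q_bounds by simp
  have h: "h = u * (9 * t - 1) / q"
    using h_eq q0 by (simp add: field_simps)
  have "x + y + z = (2 * (1 - t) + 2 * t * (9 * t - 1) + (1 - t) * (9 * t - 1)) / q\<^sup>2"
    by (simp add: x_def y_def z_def add_divide_distrib)
  also have "2 * (1 - t) + 2 * t * (9 * t - 1) + (1 - t) * (9 * t - 1) = q\<^sup>2"
    by (simp add: q_def power2_eq_square algebra_simps)
  finally have sum: "x + y + z = 1"
    using q0 by simp
  have ang: "y * z = h\<^sup>2 * x"
    by (simp add: x_def y_def z_def h power_divide power_mult_distrib t_def[symmetric])
      (simp add: power2_eq_square)
  have ar: "2 * h * x = w * (1 - w\<^sup>2)"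
  proof -
    have "q ^ 3 * (2 * h * x) = 4 * u * (9 * t - 1) * (1 - t)"
      using q0 by (simp add: x_def h power2_eq_square power3_eq_cube)
    also have "\<dots> = q ^ 3 * (w * (1 - w\<^sup>2))"
      unfolding A(2)[symmetric] A(1)[symmetric] by (simp add: power2_eq_square power3_eq_cube algebra_simps)
    finally show ?thesis
      using q0 by simp
  qed
  have "w \<noteq> h"
    using ne(1) A(1) h_eq by metis
  moreover have "2 * h * w \<noteq> 1 - w\<^sup>2"
  proof
    assume *: "2 * h * w = 1 - w\<^sup>2"
    have "2 * (h * q) * (w * q) = q\<^sup>2 * (2 * h * w)"
      by (simp add: power2_eq_square)
    also have "\<dots> = q\<^sup>2 - (w * q)\<^sup>2"
      unfolding * by (simp add: power_mult_distrib right_diff_distrib)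
    finally show False
      using ne(2) unfolding A(1) h_eq by (simp add: mult.assoc)
  qed
  moreover have "0 < x" "0 < y" "0 < z"
    using t_bounds q_bounds by (auto simp: x_def y_def z_def)
  ultimately show ?thesis
    unfolding pair_parameters_def using w sum ang ar by blast
qed

text \<open>The two heights that are rational for every rational \<open>u\<close>.\<close>

definition "w1 = (1 - u) * (3 * u + 1) / q"
definition "w2 = (3 * u - 1) * (u + 1) / q"

lemma w1_q: "w1 * q = (1 - u) * (3 * u + 1)" and w2_q: "w2 * q = (3 * u - 1) * (u + 1)"
  using q_bounds by (auto simp: w1_def w2_def)

lemma q_u: "q = 3 * u\<^sup>2 + 1"
  by (simp add: q_def t_def)

lemma pair_parameters_w1: "pair_parameters h w1"
proof (rule pair_parameters_shared_triangle[OF _ _ w1_q])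
  have "0 < (1 - u) * (3 * u + 1)"
    using u_bounds by simp
  then show "0 < w1"
    using q_bounds by (simp add: w1_def)
  have "q - (1 - u) * (3 * u + 1) = 2 * u * (3 * u - 1)"
    by (simp add: q_u power2_eq_square algebra_simps)
  also have "\<dots> > 0"
    using u_bounds by simp
  finally show "w1 < 1"
    using q_bounds by (simp add: w1_def)
  show "(1 - u) * (3 * u + 1) * (q\<^sup>2 - ((1 - u) * (3 * u + 1))\<^sup>2) = 4 * u * (9 * t - 1) * (1 - t)"
    unfolding q_u t_def by algebra
  show "(1 - u) * (3 * u + 1) \<noteq> u * (9 * t - 1)"
  proof
    assume "(1 - u) * (3 * u + 1) = u * (9 * t - 1)"
    then have "(3 * u + 1) * (3 * t - 1) = 0"
      unfolding t_def by algebra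
    then show False
      using u_bounds t_bounds by simp
  qed
  show "2 * u * (9 * t - 1) * ((1 - u) * (3 * u + 1)) \<noteq> q\<^sup>2 - ((1 - u) * (3 * u + 1))\<^sup>2"
  proof
    assume "2 * u * (9 * t - 1) * ((1 - u) * (3 * u + 1)) = q\<^sup>2 - ((1 - u) * (3 * u + 1))\<^sup>2"
    then have "2 * u * (3 * u - 1) * (3 * u - 1) * (3 * t - 1) = 0"
      unfolding q_u t_def by algebra
    then show False
      using u_bounds t_bounds by simp
  qed
qed

lemma pair_parameters_w2: "pair_parameters h w2"
proof (rule pair_parameters_shared_triangle[OF _ _ w2_q])
  have "0 < (3 * u - 1) * (u + 1)"
    using u_bounds by simp
  then show "0 < w2"
    using q_bounds by (simp add: w2_def)
  have "q - (3 * u - 1) * (u + 1) = 2 * (1 - u)"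
    by (simp add: q_u power2_eq_square algebra_simps)
  also have "\<dots> > 0"
    using u_bounds by simp
  finally show "w2 < 1"
    using q_bounds by (simp add: w2_def)
  show "(3 * u - 1) * (u + 1) * (q\<^sup>2 - ((3 * u - 1) * (u + 1))\<^sup>2) = 4 * u * (9 * t - 1) * (1 - t)"
    unfolding q_u t_def by algebra
  show "(3 * u - 1) * (u + 1) \<noteq> u * (9 * t - 1)"
  proof
    assume "(3 * u - 1) * (u + 1) = u * (9 * t - 1)"
    then have "(3 * u - 1) * (3 * t - 1) = 0"
      unfolding t_def by algebra
    then show False
      using u_bounds t_bounds by simp
  qed
  show "2 * u * (9 * t - 1) * ((3 * u - 1) * (u + 1)) \<noteq> q\<^sup>2 - ((3 * u - 1) * (u + 1))\<^sup>2"
  proof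
    assume "2 * u * (9 * t - 1) * ((3 * u - 1) * (u + 1)) = q\<^sup>2 - ((3 * u - 1) * (u + 1))\<^sup>2"
    then have "2 * u * (3 * u + 1) * (3 * u + 1) * (3 * t - 1) = 0"
      unfolding q_u t_def by algebra
    then show False
      using u_bounds t_bounds by simp
  qed
qed

text \<open>The quadratic equation \<open>6 u w\<^sup>2 - q w + 3 u (3 u\<^sup>2 - 1) = 0\<close> with discriminant \<open>v\<^sup>2\<close>.
  It is kept in this form because the positivity of \<open>w\<close> can be read off from it.\<close>

definition elliptic_root :: "rat \<Rightarrow> bool" where
  "elliptic_root w \<longleftrightarrow> w * q = 3 * u * (2 * w\<^sup>2 + 3 * t - 1)"

text \<open>Modulo the quadratic equation for \<open>w\<close>, the discriminant \<open>(1 - x)\<^sup>2 - 4 h\<^sup>2 x\<close> of the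
  quadratic polynomial with roots \<open>y\<close> and \<open>z\<close> is the square of an expression linear in \<open>w\<close>. Solving
  for \<open>y\<close> and \<open>z\<close> gives the rational formulas used in the proof. They need not be inspected for
  signs: \<open>y z = h\<^sup>2 x > 0\<close> and \<open>y + z = 1 - x > 0\<close> already force \<open>y, z > 0\<close>, where \<open>x < 1\<close> holds
  because \<open>w (1 - w\<^sup>2) < 1 < 2 h\<close>.\<close>

lemma pair_parameters_elliptic_root:
  assumes "elliptic_root w"
  shows "pair_parameters h w"
proof -
  have rel: "w * q = 3 * u * (2 * w\<^sup>2 + 3 * t - 1)"
    using assms by (simp add: elliptic_root_def)
  have q0: "q \<noteq> 0" "t \<noteq> 0" "u \<noteq> 0" "9 * t - 1 \<noteq> 0"
    using q_bounds t_bounds u_bounds by auto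
  have "0 < w * q"
    unfolding rel using u_bounds t_bounds zero_le_power2[of w] by (intro mult_pos_pos) linarith+
  then have w0: "0 < w"
    using q_bounds by (simp add: zero_less_mult_iff)
  have "w * (6 * u * w) < w * q"
    unfolding rel using u_bounds t_bounds by (simp add: power2_eq_square algebra_simps)
  then have "6 * u * w < q"
    using w0 by simp
  moreover have "3 * w \<le> 6 * u * w"
    using u_bounds w0 by simp
  ultimately have w_lt: "w < 1"
    using q_bounds by linarith
  define x y z where "x = w * (1 - w\<^sup>2) / (2 * h)"
    and "y = (9 * t - 1) * (w * (9 * t + 1) - 3 * u * (3 * t - 1)) / (72 * u * t)"
    and "z = 3 * t * (q - 4 * u * w) / (9 * t - 1)"
  have ar: "2 * h * x = w * (1 - w\<^sup>2)"
    using h_pos by (simp add: x_def)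
  have x: "2 * u * (9 * t - 1) * x = w * (1 - w\<^sup>2) * q"
    using ar h_eq by algebra
  have y: "72 * u * t * y = (9 * t - 1) * (w * (9 * t + 1) - 3 * u * (3 * t - 1))"
    using q0 by (simp add: y_def)
  have z: "(9 * t - 1) * z = 3 * t * (q - 4 * u * w)"
    using q0(4) by (simp add: z_def)
  have sum: "x + y + z = 1"
  proof -
    have "72 * u * t * (9 * t - 1) * (x + y + z)
      = 36 * t * w * (1 - w\<^sup>2) * q + (9 * t - 1)\<^sup>2 * (w * (9 * t + 1) - 3 * u * (3 * t - 1))
        + 216 * u * t\<^sup>2 * (q - 4 * u * w)"
      using x y z by algebra
    also have "\<dots> = 72 * u * t * (9 * t - 1)"
      using rel unfolding q_u t_def by algebra
    finally show ?thesis
      using q0 by simp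
  qed
  have ang: "y * z = h\<^sup>2 * x"
  proof -
    have "216 * u * t * (9 * t - 1) * q\<^sup>2 * (y * z)
      = 3 * q\<^sup>2 * (72 * u * t * y) * ((9 * t - 1) * z)"
      by algebra
    also have "\<dots> = 9 * t * (9 * t - 1) * q * (q * (w * (9 * t + 1) - 3 * u * (3 * t - 1)) * (q - 4 * u * w))"
      unfolding y z by algebra
    also have "q * (w * (9 * t + 1) - 3 * u * (3 * t - 1)) * (q - 4 * u * w) = 12 * t * (9 * t - 1) * w * (1 - w\<^sup>2)"
      using rel unfolding q_u t_def by algebra
    also have "9 * t * (9 * t - 1) * q * (12 * t * (9 * t - 1) * w * (1 - w\<^sup>2))
      = 216 * u * t * (9 * t - 1) * q\<^sup>2 * (h\<^sup>2 * x)"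
      using x h_eq uu by algebra
    finally show ?thesis
      using q0 by simp
  qed
  have w_sq: "w\<^sup>2 < 1"
    using w0 w_lt by (simp add: power_less_one_iff)
  have x0: "x > 0"
    using w0 w_sq h_pos by (simp add: x_def)
  have "w * (1 - w\<^sup>2) < 1 * 1"
    using w0 w_lt w_sq by (intro mult_strict_mono) auto
  then have "x < 1"
    using h_gt u_bounds h_pos by (simp add: x_def)
  then have "y + z > 0" "y * z > 0"
    using sum ang x0 h_pos by auto
  then have yz: "y > 0" "z > 0"
    by (auto simp: zero_less_mult_iff)
  have "w \<noteq> h"
  proof
    assume "w = h"
    then have "u * (9 * t - 1) = 3 * u * (2 * h\<^sup>2 + 3 * t - 1)"
      using rel h_eq by simp
    then have "h\<^sup>2 = 1 / 3"
      using q0 by simp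
    moreover have "t < h\<^sup>2"
      unfolding t_def using h_gt u0 by (intro power_strict_mono) auto
    ultimately show False
      using t_bounds by simp
  qed
  moreover have "2 * h * w \<noteq> 1 - w\<^sup>2"
  proof
    assume "2 * h * w = 1 - w\<^sup>2"
    then have "2 * (h * q) * w = (1 - w\<^sup>2) * q"
      by (simp add: mult_ac)
    then have "2 * u * (9 * t - 1) * w = (1 - w\<^sup>2) * q"
      unfolding h_eq by (simp add: mult_ac)
    \<comment> \<open>the resultant in \<open>w\<close> of the quadratic equation for \<open>w\<close> and of
       \<open>q w\<^sup>2 + 2 u (9 t - 1) w - q = 0\<close>\<close>
    then have "(3 * t - 1) * (6561 * t ^ 4 - 972 * t ^ 3 + 54 * t\<^sup>2 - 12 * t + 1) = 0"
      using rel unfolding q_u t_def by algebra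
    moreover have "6561 * t ^ 4 - 972 * t ^ 3 + 54 * t\<^sup>2 - 12 * t + 1
        = t ^ 3 * (6561 * t - 972) + 18 * t\<^sup>2 + (6 * t - 1)\<^sup>2"
      by (simp add: power2_eq_square power3_eq_cube power4_eq_xxxx algebra_simps)
    moreover have "t ^ 3 * (6561 * t - 972) > 0"
      using t_bounds by simp
    ultimately show False
      using t_bounds zero_le_power2[of "6 * t - 1"] zero_le_power2[of t] by auto
  qed
  ultimately show ?thesis
    unfolding pair_parameters_def using w0 w_lt x0 yz sum ang ar by blast
qed

lemma elliptic_root_formula:
  assumes "(12 * u * w - q)\<^sup>2 = v\<^sup>2"
  shows "elliptic_root w"
proof -
  have "24 * u * (w * q) = 24 * u * (3 * u * (2 * w\<^sup>2 + 3 * t - 1))"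
    using assms on_curve unfolding on_jacobi_def q_u t_def by algebra
  then show ?thesis
    unfolding elliptic_root_def using u_bounds by simp
qed

text \<open>Substituting \<open>w1\<close>, or below \<open>w2\<close>, into the quadratic equation leaves \<open>3 t - 1\<close> times a quintic
  in \<open>u\<close>. The quintic is written as a sum of terms that are positive for \<open>1 / 2 < u < 2 / 3\<close>.\<close>

lemma not_elliptic_root_w1: "\<not> elliptic_root w1"
proof
  assume "elliptic_root w1"
  then have "w1 * q = 3 * u * (2 * w1\<^sup>2 + 3 * t - 1)"
    by (simp add: elliptic_root_def)
  then have "(3 * t - 1) * (1 - u - 18 * u ^ 2 + 30 * u ^ 3 + 9 * u ^ 4 + 27 * u ^ 5) = 0"
    using w1_q unfolding q_u t_def by algebra
  moreover have "1 - u - 18 * u ^ 2 + 30 * u ^ 3 + 9 * u ^ 4 + 27 * u ^ 5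
      = (1 - u + u\<^sup>2) + u\<^sup>2 * (15 * (2 * u - 1)) + u\<^sup>2 * (9 * (t - 1 / 3) + 27 * u * (t - 1 / 3) + (9 * u - 1))"
    unfolding t_def by algebra
  moreover have "u\<^sup>2 * (15 * (2 * u - 1)) > 0" "u\<^sup>2 * (9 * (t - 1 / 3) + 27 * u * (t - 1 / 3) + (9 * u - 1)) > 0"
  proof -
    have "9 * (t - 1 / 3) + 27 * u * (t - 1 / 3) + (9 * u - 1) > 0"
      using u_bounds t_bounds by (intro add_pos_pos mult_pos_pos) auto
    then show "u\<^sup>2 * (9 * (t - 1 / 3) + 27 * u * (t - 1 / 3) + (9 * u - 1)) > 0"
      using u_bounds by (intro mult_pos_pos) auto
  qed (use u_bounds in simp)
  moreover have "1 - u + u\<^sup>2 > 0"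
    using u_bounds zero_le_power2[of u] by linarith
  ultimately show False
    using t_bounds by auto
qed

lemma not_elliptic_root_w2: "\<not> elliptic_root w2"
proof
  assume "elliptic_root w2"
  then have "w2 * q = 3 * u * (2 * w2\<^sup>2 + 3 * t - 1)"
    by (simp add: elliptic_root_def)
  then have "(3 * t - 1) * (27 * u ^ 5 - 9 * u ^ 4 + 30 * u ^ 3 + 18 * u\<^sup>2 - u - 1) = 0"
    using w2_q unfolding q_u t_def by algebra
  moreover have "27 * u ^ 5 - 9 * u ^ 4 + 30 * u ^ 3 + 18 * u\<^sup>2 - u - 1
      = 9 * u ^ 4 * (3 * u - 1) + 30 * u ^ 3 + u * (18 * u - 9) + (8 * u - 1)"
    by algebra
  moreover have "9 * u ^ 4 * (3 * u - 1) > 0" "30 * u ^ 3 > 0" "u * (18 * u - 9) > 0"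
    using u_bounds by auto
  ultimately show False
    using t_bounds u_bounds by auto
qed

text \<open>The hypothesis \<open>v \<noteq> 0\<close> keeps the two roots of the quadratic equation apart.\<close>

lemma at_least_four:
  assumes "v \<noteq> 0"
  shows "at_least_distinct_genuine_pairs 4 ((1 - h\<^sup>2) / (1 + h\<^sup>2))"
proof -
  define w3 w4 where "w3 = (q + v) / (12 * u)" and "w4 = (q - v) / (12 * u)"
  have u: "u \<noteq> 0"
    using u_bounds by simp
  have "12 * u * w3 - q = v" "12 * u * w4 - q = - v"
    using u by (auto simp: w3_def w4_def)
  then have "(12 * u * w3 - q)\<^sup>2 = v\<^sup>2" "(12 * u * w4 - q)\<^sup>2 = v\<^sup>2"
    by (simp_all only: power2_minus)
  then have root: "elliptic_root w3" "elliptic_root w4"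
    using elliptic_root_formula by blast+
  have "w3 \<noteq> w4"
    using assms u by (auto simp: w3_def w4_def)
  moreover have "w1 \<noteq> w2"
  proof
    assume "w1 = w2"
    then have "(1 - u) * (3 * u + 1) = (3 * u - 1) * (u + 1)"
      using w1_q w2_q by simp
    then have "3 * t = 1"
      unfolding t_def by algebra
    then show False
      using t_bounds by simp
  qed
  ultimately have card: "card {w1, w2, w3, w4} = 4"
    using root not_elliptic_root_w1 not_elliptic_root_w2 by (auto simp: card_insert_if)
  have par: "pair_parameters h r" if "r \<in> {w1, w2, w3, w4}" for r
    using that pair_parameters_w1 pair_parameters_w2 root[THEN pair_parameters_elliptic_root] by blast
  define W :: "real set" where "W = of_rat ` {w1, w2, w3, w4}"
  have "\<exists>T. genuine_pair ((1 - h\<^sup>2) / (1 + h\<^sup>2)) (T, isosceles_tri w)" and "0 < w \<and> w < 1"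
    if "w \<in> W" for w
  proof -
    obtain r where r: "r \<in> {w1, w2, w3, w4}" "w = of_rat r"
      using \<open>w \<in> W\<close> unfolding W_def by (elim imageE)
    show "\<exists>T. genuine_pair ((1 - h\<^sup>2) / (1 + h\<^sup>2)) (T, isosceles_tri w)"
      unfolding r(2) by (rule genuine_pair_if_pair_parameters[OF par[OF r(1)] h_pos])
    show "0 < w \<and> w < 1"
      using par[OF r(1)] unfolding r(2) pair_parameters_def by simp
  qed
  moreover have "card W = 4"
    unfolding W_def using card by (subst card_image) (auto simp: inj_on_def)
  moreover have "finite W"
    by (simp add: W_def)
  ultimately show ?thesis
    by (intro at_least_distinct_if_genuine_pairs[of W])
qed

text \<open>The fixed points \<open>- 1\<close> and \<open>3\<close> of the involution \<open>\<lambda> \<mapsto> (\<lambda> + 3) / (\<lambda> - 1)\<close>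
  correspond to \<open>u = 0\<close> and \<open>u = \<infinity>\<close>; in this coordinate the quartic is even. All identities are
  multiplied by powers of \<open>d = u + 1\<close>, so that \<open>\<lambda>\<close> enters only through \<open>\<lambda> d = 3 u - 1\<close>.\<close>

lemma quartic_point:
  defines "l \<equiv> (3 * u - 1) / (u + 1)"
  shows "(l, 2 * v / (u + 1)\<^sup>2) \<in> H_points" and "rho_ell l = (1 - h\<^sup>2) / (1 + h\<^sup>2)"
proof -
  define d where "d = u + 1"
  have d: "d \<noteq> 0" "l = (3 * u - 1) / d"
    using u0 by (auto simp: d_def l_def)
  have ld: "l * d = 3 * u - 1"
    using d by simp
  have "(2 * v / d\<^sup>2)\<^sup>2 * d ^ 4 = 4 * v\<^sup>2"
    using d(1) by (simp add: power_divide flip: power_mult)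
  also have "\<dots> = 9 * d ^ 4 - 21 * (3 * u - 1)\<^sup>2 * d\<^sup>2 - 18 * (3 * u - 1) ^ 3 * d - 2 * (3 * u - 1) ^ 4"
    using on_curve unfolding on_jacobi_def d_def by algebra
  also have "\<dots> = (9 - 21 * l\<^sup>2 - 18 * l ^ 3 - 2 * l ^ 4) * d ^ 4"
    using ld by algebra
  finally show "(l, 2 * v / (u + 1)\<^sup>2) \<in> H_points"
    using d(1) by (simp add: H_points_def flip: d_def)
  have X: "X_ell l = 2 * h"
  proof -
    have "(3 - l) * d = 4"
      using ld unfolding d_def by algebra
    then have "3 - l \<noteq> 0"
      by auto
    moreover have "l\<^sup>2 + 3 \<noteq> 0"
      using zero_le_power2[of l] by linarith
    moreover have "4 * l * (l + 1) * (l + 3) * (d ^ 3 * q) = 2 * h * ((3 - l) * (l\<^sup>2 + 3)) * (d ^ 3 * q)"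
    proof -
      have "4 * l * (l + 1) * (l + 3) * (d ^ 3 * q) = 4 * (l * d) * (l * d + d) * (l * d + 3 * d) * q"
        by algebra
      also have "\<dots> = 2 * (h * q) * (3 * d - l * d) * ((l * d)\<^sup>2 + 3 * d\<^sup>2)"
        unfolding ld h_eq unfolding d_def q_u t_def by algebra
      also have "\<dots> = 2 * h * ((3 - l) * (l\<^sup>2 + 3)) * (d ^ 3 * q)"
        by algebra
      finally show ?thesis .
    qed
    then have "4 * l * (l + 1) * (l + 3) = 2 * h * ((3 - l) * (l\<^sup>2 + 3))"
      using d(1) q_bounds by simp
    ultimately show ?thesis
      unfolding X_ell_def by (simp add: divide_eq_eq)
  qed
  have "1 + h\<^sup>2 > 0"
    by (simp add: add_pos_nonneg)
  then show "rho_ell l = (1 - h\<^sup>2) / (1 + h\<^sup>2)"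
    unfolding rho_ell_def X by (simp add: power_mult_distrib field_simps)
qed

end

section \<open>Infinitely many angles\<close>

text \<open>The difference of the two values is \<open>u - u'\<close> times a factor that is positive in this range.\<close>

lemma half_angle_tan_inj:
  assumes "u \<ge> 0" "1 / 3 < u\<^sup>2" "u' \<ge> 0" "1 / 3 < u'\<^sup>2" "half_angle_tan u = half_angle_tan u'"
  shows "u = u'"
proof -
  have "3 * u\<^sup>2 + 1 > 0" "3 * u'\<^sup>2 + 1 > 0"
    by (simp_all add: add_nonneg_pos)
  then have "u * (9 * u\<^sup>2 - 1) * (3 * u'\<^sup>2 + 1) = u' * (9 * u'\<^sup>2 - 1) * (3 * u\<^sup>2 + 1)"
    using assms(5) by (simp add: half_angle_tan_def frac_eq_eq)
  then have "(u - u') * (27 * (u\<^sup>2 * u'\<^sup>2) + 9 * (u\<^sup>2 + u * u' + u'\<^sup>2) + 3 * (u * u') - 1) = 0"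
    by algebra
  moreover have "27 * (u\<^sup>2 * u'\<^sup>2) + 9 * (u\<^sup>2 + u * u' + u'\<^sup>2) + 3 * (u * u') - 1 > 0"
  proof -
    have uu': "0 \<le> u * u'"
      using assms by simp
    have "0 \<le> 27 * (u\<^sup>2 * u'\<^sup>2)"
      by simp
    moreover have "1 < 9 * u\<^sup>2" "1 < 9 * u'\<^sup>2"
      using assms(2,4) by auto
    moreover have "9 * (u\<^sup>2 + u * u' + u'\<^sup>2) = 9 * u\<^sup>2 + 9 * (u * u') + 9 * u'\<^sup>2"
      by (simp add: distrib_left)
    ultimately show ?thesis
      using uu' by linarith
  qed
  ultimately show ?thesis
    by auto
qed

lemma cos_half_angle_inj:
  fixes a b :: rat
  assumes "a > 0" "b > 0" "(1 - a\<^sup>2) / (1 + a\<^sup>2) = (1 - b\<^sup>2) / (1 + b\<^sup>2)"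
  shows "a = b"
proof -
  have "1 + a\<^sup>2 > 0" "1 + b\<^sup>2 > 0"
    by (simp_all add: add_pos_nonneg)
  then have "(1 - a\<^sup>2) * (1 + b\<^sup>2) = (1 - b\<^sup>2) * (1 + a\<^sup>2)"
    using assms(3) by (simp add: frac_eq_eq)
  then have "a\<^sup>2 = b\<^sup>2"
    by algebra
  then show ?thesis
    using assms by (simp add: power2_eq_iff_nonneg)
qed

theorem theorem9p4:
  shows "infinite {\<rho> :: rat. \<rho> \<in> {-1<..<1} \<and>
           (\<exists>l V. (l, V) \<in> H_points \<and> \<rho> = rho_ell l) \<and>
           at_least_distinct_genuine_pairs 4 \<rho>}"
proof -
  \<comment> \<open>abscissae of points with \<open>v = 0\<close>, over which two of the four pairs would coincide\<close>
  define Z where "Z = {u :: rat. poly [:1, 0, 78, 0, -207:] u = 0}"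
  define S where "S = {u \<in> jacobi_abscissae. 1 / 3 < u\<^sup>2} - Z"
  define f where "f u = (1 - (half_angle_tan u)\<^sup>2) / (1 + (half_angle_tan u)\<^sup>2)" for u
  have "finite Z"
    unfolding Z_def by (rule poly_roots_finite) simp
  then have "infinite S"
    unfolding S_def using infinite_jacobi_abscissae_outer by (rule Diff_infinite_finite)
  have good: "\<exists>v. good_point u v \<and> v \<noteq> 0" if uS: "u \<in> S" for u
  proof -
    obtain v where v: "on_jacobi u v" and u: "u \<ge> 0" "1 / 3 < u\<^sup>2" "u \<notin> Z"
      using uS unfolding S_def jacobi_abscissae_def by blast
    have "v\<^sup>2 = poly [:1, 0, 78, 0, -207:] u"
      using v by (simp add: on_jacobi_def power2_eq_square power4_eq_xxxx algebra_simps)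
    then have "v \<noteq> 0"
      using u(3) by (auto simp: Z_def)
    then show ?thesis
      using u v by (intro exI[of _ "\<bar>v\<bar>"]) (auto simp: good_point_def on_jacobi_def)
  qed
  have "inj_on f S"
  proof (rule inj_onI)
    fix u u' assume uu: "u \<in> S" "u' \<in> S" "f u = f u'"
    obtain v v' where g: "good_point u v" "good_point u' v'"
      using good[OF uu(1)] good[OF uu(2)] by blast
    have "half_angle_tan u = half_angle_tan u'"
      using uu(3) unfolding f_def by (rule cos_half_angle_inj[OF good_point.h_pos[OF g(1)] good_point.h_pos[OF g(2)]])
    then show "u = u'"
      by (rule half_angle_tan_inj[OF good_point.u0[OF g(1)] good_point.u_sq[OF g(1)]
            good_point.u0[OF g(2)] good_point.u_sq[OF g(2)]])
  qed
  then have "infinite (f ` S)"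
    using \<open>infinite S\<close> by (simp add: finite_image_iff)
  moreover have "f ` S \<subseteq> {\<rho> :: rat. \<rho> \<in> {-1<..<1} \<and>
           (\<exists>l V. (l, V) \<in> H_points \<and> \<rho> = rho_ell l) \<and>
           at_least_distinct_genuine_pairs 4 \<rho>}"
  proof
    fix \<rho> assume "\<rho> \<in> f ` S"
    then obtain u v where u: "\<rho> = f u" "good_point u v" "v \<noteq> 0"
      using good by (metis imageE)
    have h: "half_angle_tan u > 0"
      using u(2) by (rule good_point.h_pos)
    have "0 < 1 + (half_angle_tan u)\<^sup>2"
      by (simp add: add_pos_nonneg)
    then have "\<rho> \<in> {-1<..<1}"
      using h by (simp add: u(1) f_def field_simps)
    moreover have "\<exists>l V. (l, V) \<in> H_points \<and> \<rho> = rho_ell l"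
      unfolding u(1) f_def by (intro exI conjI, rule good_point.quartic_point(1)[OF u(2)],
          rule good_point.quartic_point(2)[OF u(2), symmetric])
    moreover have "at_least_distinct_genuine_pairs 4 \<rho>"
      using good_point.at_least_four[OF u(2,3)] unfolding u(1) f_def .
    ultimately show "\<rho> \<in> {\<rho> :: rat. \<rho> \<in> {-1<..<1} \<and>
           (\<exists>l V. (l, V) \<in> H_points \<and> \<rho> = rho_ell l) \<and>
           at_least_distinct_genuine_pairs 4 \<rho>}"
      by blast
  qed
  ultimately show ?thesis
    by (rule infinite_super[rotated])
qed

end
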